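(* For every symmetric numerical semigroup $S$, $\dim_{\mathrm{mat}} S \geq m(S)$.
   Context: $\mathbb{N} = \{0,1,2,\ldots\}$. A numerical semigroup is an additive subsemigroup of $\mathbb{N}$ containing $0$ whose complement in $\mathbb{N}$ is finite. Its Frobenius number $g(S)$ is the largest natural number not in $S$ (with the usual convention $g(\mathbb{N}) = -1$). $S$ is symmetric if $g(S)$ is odd and, for every $x \in \mathbb{Z}\setminus S$, $g(S) - x \in S$. The multiplicity $m(S)$ is the least element of the unique minimal generating set of $S$, i.e. the least positive element of $S$. For $A \in \mathrm{M}_d(\mathbb{Q})$ ($d \times d$ rational matrices), the exponent semigroup is $\mathcal{S}(A) = \{ n \in \mathbb{N} : A^n \in \mathrm{M}_d(\mathbb{Z})\}$, where $A^0=I$. The matricial dimension is $\dim_{\mathrm{mat}} S = \min\{ d \geq 1 : \text{there is an } A \in \mathrm{M}_d(\mathbb{Q}) \text{ such that } S = \mathcal{S}(A)\}$ (such $d$ exists for every additive subsemigroup of $\mathbb{N}$ containing $0$). *)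

theory Defs
  imports Complex_Main "Jordan_Normal_Form.Matrix"
begin

definition numerical_semigroup :: "nat set \<Rightarrow> bool" where
  "numerical_semigroup S \<longleftrightarrow>
     0 \<in> S \<and> (\<forall>a\<in>S. \<forall>b\<in>S. a + b \<in> S) \<and> finite (UNIV - S)"

text \<open>Integer-valued because of the convention that the Frobenius number of the full semigroup
  of natural numbers is \<open>-1\<close>; meant for sets with finite complement only.\<close>

definition frobenius_number :: "nat set \<Rightarrow> int" where
  "frobenius_number S = (if S = UNIV then -1 else int (Max (UNIV - S)))"

definition symmetric_numerical_semigroup :: "nat set \<Rightarrow> bool" where
  "symmetric_numerical_semigroup S \<longleftrightarrow>
     numerical_semigroup S \<and> odd (frobenius_number S) \<and>
     (\<forall>x::int. x \<notin> int ` S \<longrightarrow> frobenius_number S - x \<in> int ` S)"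

definition multiplicity_of_semigroup :: "nat set \<Rightarrow> nat" where
  "multiplicity_of_semigroup S = (LEAST n. n \<in> S \<and> 0 < n)"

text \<open>The matrix power satisfies \<open>A ^\<^sub>m 0 = 1\<^sub>m (dim_row A)\<close>, and a matrix with rational
  entries is integral iff all its entries lie in \<open>\<int>\<close>.\<close>

definition exponent_semigroup :: "rat mat \<Rightarrow> nat set" where
  "exponent_semigroup A = {n. elements_mat (A ^\<^sub>m n) \<subseteq> \<int>}"

text \<open>A minimum of a nonempty set for every additive submonoid \<open>S\<close> of the natural numbers;
  unspecified for other \<open>S\<close>.\<close>

definition matricial_dimension :: "nat set \<Rightarrow> nat" where
  "matricial_dimension S =
     (LEAST d. 1 \<le> d \<and> (\<exists>A \<in> carrier_mat d d. S = exponent_semigroup A))"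

end

theory Submission
  imports Defs "Jordan_Normal_Form.Char_Poly"
begin

text \<open>Let \<open>S\<close> be symmetric with multiplicity \<open>m\<close> and Frobenius number \<open>g\<close>, and let \<open>A\<close> be a rational
  \<open>d \<times> d\<close> matrix with exponent semigroup \<open>S\<close>. As \<open>d \<ge> 1\<close>, assume \<open>m > 1\<close>. The numbers \<open>1, \<dots>, m - 1\<close> are gaps of \<open>S\<close>, so by
  symmetry \<open>g - 1, \<dots>, g - (m - 1)\<close> lie in \<open>S\<close>, while \<open>g\<close> does not: the integrality of the powers of
  \<open>A\<close> breaks down at \<open>g\<close> immediately after \<open>m - 1\<close> consecutive integral powers. This is impossible
  for \<open>d < m\<close>, because some positive power of \<open>A\<close> is integral, which makes the minimal polynomial
  of \<open>A\<close> integral: it is a monic polynomial of degree at most \<open>d\<close> with integer coefficients, hence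
  it writes \<open>A\<^sup>g\<close> as an integer combination of the at most \<open>d\<close> powers that precede it
  (\<open>exponent_semigroup_window\<close>).

  The minimal polynomial is integral by a form of Gauss's lemma (\<open>monic_dvd_monic_int_poly\<close>):
  if \<open>A\<^sup>N\<close> is an integer matrix with characteristic polynomial \<open>\<chi>\<close>, then the monic integer
  polynomial \<open>\<chi>(x\<^sup>N)\<close> annihilates \<open>A\<close>, so the minimal polynomial is a monic divisor of it. That its
  degree is at most \<open>d\<close>, and that \<open>\<chi>\<close> annihilates \<open>A\<^sup>N\<close>, is the Cayley--Hamilton theorem
  (\<open>cayley_hamilton_shift\<close>). A polynomial in \<open>A\<close> is treated here through the scalar sequences of the
  entries of \<open>A\<^sup>n\<close>: a polynomial annihilates \<open>A\<close> iff it is the characteristic polynomial of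
  a linear recurrence that all these sequences satisfy.

  The matricial dimension being a minimum, it must also be known that some matrix has the exponent
  semigroup \<open>S\<close>; this is \<open>cofinite_monoid_is_exponent_semigroup\<close>.\<close>

section \<open>Polynomials acting on sequences\<close>

text \<open>This is the module structure on sequences over the polynomial ring in which the
  indeterminate acts as the shift, so that \<open>shift_act p u = 0\<close> says that \<open>u\<close> satisfies the
  linear recurrence with characteristic polynomial \<open>p\<close>.\<close>

definition shift_act :: "'a::comm_ring_1 poly \<Rightarrow> (nat \<Rightarrow> 'a) \<Rightarrow> nat \<Rightarrow> 'a" where
  "shift_act p u n = (\<Sum>k\<le>degree p. coeff p k * u (n + k))"

lemma shift_act_pCons:
  "shift_act (pCons a p) u n = a * u n + shift_act p u (Suc n)"
proof (cases "p = 0")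
  case True
  then show ?thesis by (simp add: shift_act_def)
next
  case False
  then show ?thesis
    by (simp add: shift_act_def sum.atMost_Suc_shift del: sum.atMost_Suc)
qed

lemma shift_act_0_left [simp]: "shift_act 0 u n = 0"
  by (simp add: shift_act_def)

lemma shift_act_add_left: "shift_act (p + q) u n = shift_act p u n + shift_act q u n"
  by (induction p q arbitrary: n rule: poly_induct2)
     (simp_all add: shift_act_pCons algebra_simps)

lemma shift_act_smult_left: "shift_act (smult c p) u n = c * shift_act p u n"
  by (induction p arbitrary: n) (simp_all add: shift_act_pCons algebra_simps)

lemma shift_act_mult: "shift_act (p * q) u n = shift_act p (shift_act q u) n"
  by (induction p arbitrary: n)
     (simp_all add: shift_act_pCons shift_act_add_left shift_act_smult_left)

lemma shift_act_sum_left: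
  "shift_act (\<Sum>i\<in>I. p i) u n = (\<Sum>i\<in>I. shift_act (p i) u n)"
  by (induction I rule: infinite_finite_induct) (simp_all add: shift_act_add_left)

lemma shift_act_sum_right:
  "shift_act p (\<lambda>m. \<Sum>i\<in>I. u i m) n = (\<Sum>i\<in>I. shift_act p (u i) n)"
  by (simp add: shift_act_def sum_distrib_left sum.swap[of _ I])

text \<open>Substituting \<open>x\<^sup>N\<close> for \<open>x\<close> amounts to looking at the subsequence along an arithmetic
  progression with difference \<open>N\<close>; for entries of powers of \<open>A\<close>, such subsequences belong to the
  powers of \<open>A\<^sup>N\<close>.\<close>

lemma shift_act_pcompose_monom:
  "shift_act (pcompose p (monom 1 N)) u (r + N * j) = shift_act p (\<lambda>k. u (r + N * k)) j"
proof (induction p arbitrary: j)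
  case (pCons a p)
  have shift: "shift_act (monom 1 M) v n = v (n + M)" for M n and v :: "nat \<Rightarrow> 'a"
    by (induction M arbitrary: n) (simp_all add: monom_0 monom_Suc shift_act_pCons)
  have "shift_act (pcompose p (monom 1 N)) u (r + N * j + N)
      = shift_act (pcompose p (monom 1 N)) u (r + N * Suc j)"
    by (simp add: algebra_simps)
  also have "\<dots> = shift_act p (\<lambda>k. u (r + N * k)) (Suc j)"
    by (rule pCons.IH)
  finally show ?case
    by (simp add: pcompose_pCons shift_act_add_left shift_act_mult shift shift_act_pCons)
qed simp

section \<open>The Cayley--Hamilton theorem for linear recurrences\<close>

lemma pow_mat_add:
  assumes A: "(A :: 'a::semiring_1 mat) \<in> carrier_mat d d"
  shows "A ^\<^sub>m (m + n) = A ^\<^sub>m m * A ^\<^sub>m n"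
proof (induction n)
  case 0
  then show ?case using A by simp
next
  case (Suc n)
  then show ?case
    using A assoc_mult_mat[of "A ^\<^sub>m m" d d "A ^\<^sub>m n" d A d] by simp
qed

lemma index_mult_mat_sum:
  assumes "A \<in> carrier_mat a b" "B \<in> carrier_mat b c" "i < a" "j < c"
  shows "(A * B) $$ (i, j) = (\<Sum>l<b. A $$ (i, l) * B $$ (l, j))"
  using assms by (auto simp: scalar_prod_def atLeast0LessThan intro!: sum.cong)

text \<open>The determinant trick. The hypothesis on \<open>u\<close> is the linear system \<open>(x I - A) u = 0\<close> over
  the polynomial ring, with \<open>x\<close> acting as the shift. Multiplying it from the left by the
  adjugate of \<open>x I - A\<close> makes \<open>det (x I - A)\<close> annihilate every component of \<open>u\<close>.\<close>

theorem cayley_hamilton_shift: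
  fixes A :: "'a::comm_ring_1 mat"
  assumes A: "A \<in> carrier_mat d d"
    and u: "\<And>i n. i < d \<Longrightarrow> u i (Suc n) = (\<Sum>l<d. A $$ (i, l) * u l n)"
    and k: "k < d"
  shows "shift_act (char_poly A) (u k) n = 0"
proof -
  define M where "M = char_poly_matrix A"
  have M: "M \<in> carrier_mat d d" using A by (simp add: M_def)
  have row: "(\<Sum>l<d. shift_act (M $$ (i, l)) (u l) n) = 0" if i: "i < d" for i n
  proof -
    have "shift_act (M $$ (i, l)) (u l) n = (if l = i then u i (Suc n) else 0) - A $$ (i, l) * u l n"
      if "l < d" for l
      using i that A
      by (auto simp: M_def char_poly_matrix_def shift_act_pCons one_pCons)
    then have "(\<Sum>l<d. shift_act (M $$ (i, l)) (u l) n)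
        = (\<Sum>l<d. (if l = i then u i (Suc n) else 0) - A $$ (i, l) * u l n)"
      by (intro sum.cong) auto
    also have "\<dots> = 0"
      using i by (simp add: sum_subtractf u)
    finally show ?thesis .
  qed
  have adj: "(\<Sum>i<d. adj_mat M $$ (k, i) * M $$ (i, l)) = (if l = k then char_poly A else 0)"
    if "l < d" for l
    using index_mult_mat_sum[OF adj_mat(1)[OF M] M k that] adj_mat(3)[OF M] k that
    by (auto simp: M_def char_poly_def)
  have "shift_act (char_poly A) (u k) n
      = (\<Sum>l<d. shift_act (if l = k then char_poly A else 0) (u l) n)"
    using k by (simp add: if_distrib[of "\<lambda>p. shift_act p _ n"] cong: if_cong)
  also have "\<dots> = (\<Sum>l<d. \<Sum>i<d. shift_act (adj_mat M $$ (k, i)) (shift_act (M $$ (i, l)) (u l)) n)"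
    by (intro sum.cong refl) (simp add: adj[symmetric] shift_act_sum_left shift_act_mult)
  also have "\<dots> = (\<Sum>i<d. shift_act (adj_mat M $$ (k, i)) (\<lambda>m. \<Sum>l<d. shift_act (M $$ (i, l)) (u l) m) n)"
    by (subst sum.swap) (simp add: shift_act_sum_right)
  also have "\<dots> = 0"
    by (simp add: row) (simp add: shift_act_def)
  finally show ?thesis .
qed

lemma pow_mat_add_entry:
  assumes A: "(A :: 'a::comm_semiring_1 mat) \<in> carrier_mat d d" and "i < d" "j < d"
  shows "(A ^\<^sub>m (N + n)) $$ (i, j) = (\<Sum>l<d. (A ^\<^sub>m N) $$ (i, l) * (A ^\<^sub>m n) $$ (l, j))"
  using index_mult_mat_sum[of "A ^\<^sub>m N" d d "A ^\<^sub>m n" d i j] assms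
  by (simp add: pow_mat_add)

section \<open>Integrality of the minimal polynomial\<close>

lemma common_denominator_poly:
  obtains c :: int and P :: "int poly"
  where "c > 0" "smult (of_int c) (p :: rat poly) = of_int_poly P"
proof -
  have "\<exists>c P. c > 0 \<and> smult (of_int c) p = of_int_poly P"
  proof (induction p)
    case 0
    show ?case by (rule exI[of _ 1], rule exI[of _ 0]) simp
  next
    case (pCons a p)
    then obtain c P where cP: "c > 0" "smult (of_int c) p = of_int_poly P" by blast
    obtain x y where a: "a = of_int x / of_int y" "y > 0"
      by (metis quotient_of_div quotient_of_denom_pos surj_pair)
    have "smult (of_int (c * y)) (pCons a p) = of_int_poly (pCons (c * x) (smult y P))"
      using a cP(2)[symmetric] by (simp add: map_poly_pCons ac_simps hom_distribs)
    with cP a show ?case by (metis mult_pos_pos)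
  qed
  with that show ?thesis by blast
qed

text \<open>Write the monic integer polynomial as \<open>h k\<close> and clear denominators, \<open>H = c h\<close> and
  \<open>K = b k\<close>. The content of \<open>K\<close> divides its leading coefficient \<open>b\<close>, and contents multiply to
  \<open>c b\<close>, so \<open>c\<close> divides the content of \<open>H\<close> and can be cancelled from its coefficients.\<close>

lemma monic_dvd_monic_int_poly:
  fixes h :: "rat poly"
  assumes h: "lead_coeff h = 1" and f: "lead_coeff f = 1" and dvd: "h dvd of_int_poly f"
  shows "coeff h n \<in> \<int>"
proof -
  from dvd obtain k where hk: "of_int_poly f = h * k" by (elim dvdE)
  have k: "lead_coeff k = 1"
    using arg_cong[OF hk, of lead_coeff] h f by (simp add: lead_coeff_mult)
  obtain c H where H: "c > 0" "smult (of_int c) h = of_int_poly H"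
    by (rule common_denominator_poly)
  obtain b K where K: "b > 0" "smult (of_int b) k = of_int_poly K"
    by (rule common_denominator_poly)
  have "of_int_poly (H * K) = (of_int_poly (smult (c * b) f) :: rat poly)"
    using H(2)[symmetric] K(2)[symmetric] by (simp add: hk hom_distribs mult_ac)
  then have HK: "H * K = smult (c * b) f"
    by (simp only: of_int_poly_hom.eq_iff)
  have lead: "lead_coeff H = c" "lead_coeff K = b"
    using arg_cong[OF H(2), of lead_coeff] arg_cong[OF K(2), of lead_coeff] h k H(1) K(1)
    by simp_all
  have "content f dvd 1"
    using content_dvd_coeff[of f "degree f"] f by simp
  then have "content f = 1" by (rule is_unit_content_iff[THEN iffD1])
  then have cont: "content H * content K = c * b"
    using arg_cong[OF HK, of content] H(1) K(1) by (simp add: content_mult abs_mult)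
  moreover obtain y where "b = content K * y"
    using content_dvd_coeff[of K "degree K"] lead by (auto elim: dvdE)
  moreover from this have "content K \<noteq> 0" using K(1) by auto
  ultimately have "content H = c * y" by simp
  then have "c dvd content H" by simp
  then obtain x where "coeff H n = c * x"
    by (metis content_dvd_coeff dvdE dvd_trans)
  moreover have "of_int c * coeff h n = of_int (coeff H n)"
    using arg_cong[OF H(2), of "\<lambda>p. coeff p n"] by simp
  ultimately have "coeff h n = of_int x" using H(1) by simp
  then show ?thesis by simp
qed


text \<open>The polynomial obtained is the minimal polynomial of \<open>A\<close>, chosen as a monic annihilator of
  least degree: the characteristic polynomial bounds its degree, and division with remainder
  shows that it divides the monic integer annihilator coming from the integral power.\<close>

lemma integral_power_imp_integral_recurrence:
  fixes A :: "rat mat"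
  assumes A: "A \<in> carrier_mat d d" and N: "N > 0" and int: "elements_mat (A ^\<^sub>m N) \<subseteq> \<int>"
  obtains h where "lead_coeff h = 1" "degree h \<le> d" "\<And>k. coeff h k \<in> \<int>"
    "\<And>i j n. i < d \<Longrightarrow> j < d \<Longrightarrow> shift_act h (\<lambda>m. (A ^\<^sub>m m) $$ (i, j)) n = 0"
proof -
  define ann where "ann p \<longleftrightarrow>
    (\<forall>i<d. \<forall>j<d. \<forall>n. shift_act p (\<lambda>m. (A ^\<^sub>m m) $$ (i, j)) n = 0)" for p
  have char: "ann (char_poly A)"
    unfolding ann_def
  proof (intro allI impI)
    fix i j n assume "i < d" "j < d"
    then show "shift_act (char_poly A) (\<lambda>m. (A ^\<^sub>m m) $$ (i, j)) n = 0"
      using pow_mat_add_entry[OF A, of _ j 1] A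
      by (intro cayley_hamilton_shift[OF A, of "\<lambda>i m. (A ^\<^sub>m m) $$ (i, j)"]) simp_all
  qed
  obtain h where h: "ann h" "lead_coeff h = 1"
    and least: "\<And>p. ann p \<Longrightarrow> lead_coeff p = 1 \<Longrightarrow> degree h \<le> degree p"
    using ex_has_least_nat[of "\<lambda>p. ann p \<and> lead_coeff p = 1" "char_poly A" degree]
      char degree_monic_char_poly[OF A] by auto

  define B where "B = map_mat floor (A ^\<^sub>m N)"
  have B: "B \<in> carrier_mat d d" and AN: "A ^\<^sub>m N = map_mat of_int B"
  proof -
    show "B \<in> carrier_mat d d" using A by (simp add: B_def)
    have "of_int \<lfloor>(A ^\<^sub>m N) $$ (i, j)\<rfloor> = (A ^\<^sub>m N) $$ (i, j)" if "i < d" "j < d" for i j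
    proof -
      have "(A ^\<^sub>m N) $$ (i, j) \<in> \<int>"
        using int that A by (auto intro: elements_matI[OF pow_carrier_mat[OF A]])
      then show ?thesis by (auto elim: Ints_cases)
    qed
    note floor_entry = this
    then show "A ^\<^sub>m N = map_mat of_int B"
      using A N by (intro eq_matI) (auto simp: B_def floor_entry)
  qed
  define f where "f = pcompose (char_poly B) (monom 1 N)"
  have f: "lead_coeff f = 1"
    using N degree_monic_char_poly[OF B]
    unfolding f_def by (subst lead_coeff_comp) (simp_all add: degree_monom_eq)
  have of_int_f: "of_int_poly f = pcompose (char_poly (A ^\<^sub>m N)) (monom 1 N)"
    unfolding f_def AN of_int_hom.char_poly_hom[OF B]
    by (simp add: of_int_hom.map_poly_pcompose)
  have ann_f: "ann (of_int_poly f)"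
    unfolding ann_def
  proof (intro allI impI)
    fix i j n assume ij: "i < d" "j < d"
    have "shift_act (char_poly (A ^\<^sub>m N)) (\<lambda>k. (A ^\<^sub>m (n + N * k)) $$ (i, j)) 0 = 0"
    proof (rule cayley_hamilton_shift[of _ d "\<lambda>i k. (A ^\<^sub>m (n + N * k)) $$ (i, j)"])
      fix i m assume "i < d"
      then show "(A ^\<^sub>m (n + N * Suc m)) $$ (i, j)
          = (\<Sum>l<d. (A ^\<^sub>m N) $$ (i, l) * (A ^\<^sub>m (n + N * m)) $$ (l, j))"
        using pow_mat_add_entry[OF A, of i j N "n + N * m"] ij
        by (simp add: add_ac)
    qed (use A ij in auto)
    then show "shift_act (of_int_poly f) (\<lambda>m. (A ^\<^sub>m m) $$ (i, j)) n = 0"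
      using shift_act_pcompose_monom[of "char_poly (A ^\<^sub>m N)" N "\<lambda>m. (A ^\<^sub>m m) $$ (i, j)" n 0]
      by (simp add: of_int_f)
  qed

  \<comment> \<open>A nonzero remainder, made monic, would be an annihilator of smaller degree than \<open>h\<close>.\<close>
  have "of_int_poly f mod h = 0"
  proof (rule ccontr)
    let ?F = "of_int_poly f :: rat poly"
    let ?r = "?F mod h"
    assume r: "?r \<noteq> 0"
    have "ann ?r"
      unfolding ann_def
    proof (intro allI impI)
      fix i j n assume ij: "i < d" "j < d"
      let ?u = "\<lambda>m. (A ^\<^sub>m m) $$ (i, j)"
      have "shift_act h ?u = (\<lambda>_. 0)"
        using h(1) ij by (auto simp: ann_def)
      moreover have "shift_act (?F div h * h + ?r) ?u n = 0"
        using ann_f ij by (simp add: ann_def)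
      ultimately show "shift_act ?r ?u n = 0"
        unfolding shift_act_add_left shift_act_mult by (simp add: shift_act_def)
    qed
    then have "ann (smult (inverse (lead_coeff ?r)) ?r)"
      by (simp add: ann_def shift_act_smult_left)
    from least[OF this] r have "degree h \<le> degree ?r" by simp
    moreover have "h \<noteq> 0" using h(2) by auto
    ultimately show False
      using degree_mod_less[of h ?F] r by simp
  qed
  then have "h dvd of_int_poly f" by (simp add: mod_eq_0_iff_dvd)
  then have "coeff h k \<in> \<int>" for k
    by (rule monic_dvd_monic_int_poly[OF h(2) f])
  moreover have "degree h \<le> d"
    using least[OF char] degree_monic_char_poly[OF A] by simp
  ultimately show ?thesis
    using that h by (auto simp: ann_def)
qed

section \<open>Exponent semigroups\<close>

lemma exponent_semigroup_iff:
  assumes A: "A \<in> carrier_mat d d"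
  shows "n \<in> exponent_semigroup A \<longleftrightarrow> (\<forall>i<d. \<forall>j<d. (A ^\<^sub>m n) $$ (i, j) \<in> \<int>)"
proof -
  have "M \<in> carrier_mat d d \<Longrightarrow> elements_mat M \<subseteq> \<int> \<longleftrightarrow> (\<forall>i<d. \<forall>j<d. M $$ (i, j) \<in> \<int>)"
    for M :: "rat mat" by blast
  from this[OF pow_carrier_mat[OF A]] show ?thesis
    by (simp add: exponent_semigroup_def)
qed

text \<open>The integral recurrence has order at most \<open>d\<close> and leading coefficient one, so it propagates
  integrality from \<open>d\<close> consecutive powers to the next one.\<close>

lemma exponent_semigroup_window:
  assumes A: "A \<in> carrier_mat d d" and N: "N > 0" "N \<in> exponent_semigroup A"
    and window: "\<And>k. 0 < k \<Longrightarrow> k \<le> d \<Longrightarrow> k \<le> g \<and> g - k \<in> exponent_semigroup A"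
  shows "g \<in> exponent_semigroup A"
proof -
  have "elements_mat (A ^\<^sub>m N) \<subseteq> \<int>"
    using N(2) by (simp add: exponent_semigroup_def)
  then obtain h where h: "lead_coeff h = 1" "degree h \<le> d" "\<And>k. coeff h k \<in> \<int>"
    "\<And>i j n. i < d \<Longrightarrow> j < d \<Longrightarrow> shift_act h (\<lambda>m. (A ^\<^sub>m m) $$ (i, j)) n = 0"
    using integral_power_imp_integral_recurrence[OF A N(1)] by blast
  \<comment> \<open>The recurrence reaches back to \<open>g - degree h\<close>, which must be a genuine exponent.\<close>
  have deg: "degree h \<le> g"
    using window[of "degree h"] h(2) by (cases "degree h = 0") auto
  show ?thesis
    unfolding exponent_semigroup_iff[OF A]
  proof (intro allI impI)
    fix i j assume ij: "i < d" "j < d"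
    let ?u = "\<lambda>m. (A ^\<^sub>m m) $$ (i, j)"
    have "0 = shift_act h ?u (g - degree h)"
      using h(4)[OF ij] by simp
    also have "\<dots> = (\<Sum>k<degree h. coeff h k * ?u (g - degree h + k)) + ?u g"
      using deg h(1) by (simp add: shift_act_def lessThan_Suc_atMost[symmetric])
    finally have "?u g = - (\<Sum>k<degree h. coeff h k * ?u (g - degree h + k))"
      by linarith
    also have "\<dots> \<in> \<int>"
    proof (intro Ints_minus Ints_sum Ints_mult h(3))
      fix k assume k: "k \<in> {..<degree h}"
      then have eq: "g - degree h + k = g - (degree h - k)"
        using deg by auto
      have "g - (degree h - k) \<in> exponent_semigroup A"
        using window[of "degree h - k"] k h(2) by auto
      then show "?u (g - degree h + k) \<in> \<int>"
        using ij unfolding eq exponent_semigroup_iff[OF A] by blast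
    qed
    finally show "?u g \<in> \<int>" .
  qed
qed

text \<open>A nilpotent weighted shift realizes \<open>S\<close>. With superdiagonal weights \<open>t\<^bsub>i+1\<^esub> / t\<^bsub>i\<^esub>\<close>, the
  nonzero entries of the \<open>n\<close>-th power telescope to \<open>t\<^bsub>i+n\<^esub> / t\<^bsub>i\<^esub>\<close>. When \<open>t\<close> is \<open>2\<close> on \<open>S\<close> and
  \<open>1\<close> off \<open>S\<close>, such a quotient is fractional exactly for \<open>i \<in> S\<close> and \<open>i + n \<notin> S\<close>. Closure under
  addition excludes this for \<open>n \<in> S\<close>, and \<open>i = 0\<close> is an instance of it for every gap \<open>n\<close>; the bound
  \<open>d\<close> ensures that the entry at \<open>(0, n)\<close> exists.\<close>

lemma cofinite_monoid_is_exponent_semigroup: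
  assumes S: "0 \<in> S" "\<And>a b. a \<in> S \<Longrightarrow> b \<in> S \<Longrightarrow> a + b \<in> S" and gaps: "\<And>n. n \<notin> S \<Longrightarrow> n < d"
  obtains A where "A \<in> carrier_mat d d" "S = exponent_semigroup A"
proof -
  define t :: "nat \<Rightarrow> rat" where "t i = (if i \<in> S then 2 else 1)" for i
  define A where "A = mat d d (\<lambda>(i, j). if j = Suc i then t j / t i else 0)"
  have A_entry: "A $$ (i, j) = (if j = Suc i then t j / t i else 0)" if "i < d" "j < d" for i j
    using that by (simp add: A_def)
  have t: "t i \<noteq> 0" for i by (simp add: t_def)
  have A: "A \<in> carrier_mat d d" by (simp add: A_def)
  have pow: "(A ^\<^sub>m n) $$ (i, j) = (if j = i + n then t j / t i else 0)"
    if "i < d" "j < d" for n i j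
    using that
  proof (induction n arbitrary: j)
    case 0
    then show ?case using A t by simp
  next
    case (Suc n)
    have "(A ^\<^sub>m Suc n) $$ (i, j) = (\<Sum>l<d. (A ^\<^sub>m n) $$ (i, l) * A $$ (l, j))"
      using pow_mat_add_entry[OF A Suc.prems, of n 1] A by simp
    also have "\<dots> = (\<Sum>l<d. if l = i + n then (if j = Suc l then t j / t i else 0) else 0)"
      using Suc.prems by (intro sum.cong) (auto simp: Suc.IH A_entry t)
    also have "\<dots> = (if j = i + Suc n then t j / t i else 0)"
      using Suc.prems by auto
    finally show ?case .
  qed
  have "n \<in> S \<longleftrightarrow> n \<in> exponent_semigroup A" for n
  proof
    assume n: "n \<in> S"
    then show "n \<in> exponent_semigroup A"
      using S(2)[OF _ n] by (auto simp: exponent_semigroup_iff[OF A] pow t_def)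
  next
    assume n: "n \<in> exponent_semigroup A"
    show "n \<in> S"
    proof (rule ccontr)
      assume "n \<notin> S"
      with gaps have "n < d" by blast
      then have half: "(A ^\<^sub>m n) $$ (0, n) = 1 / 2"
        using pow[of 0 n n] S(1) \<open>n \<notin> S\<close> by (simp add: t_def)
      have "(A ^\<^sub>m n) $$ (0, n) \<in> \<int>"
        using n \<open>n < d\<close> by (auto simp: exponent_semigroup_iff[OF A])
      then have "(1 / 2 :: rat) \<in> \<int>"
        unfolding half .
      then show False
        by simp
    qed
  qed
  then show ?thesis using that A by blast
qed

section \<open>The lower bound for symmetric semigroups\<close>

theorem theorem5p3:
  fixes S :: "nat set"
  assumes "symmetric_numerical_semigroup S"
  shows "matricial_dimension S \<ge> multiplicity_of_semigroup S"
proof -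
  define m where "m = multiplicity_of_semigroup S"
  define g where "g = frobenius_number S"
  have S: "0 \<in> S" "\<And>a b. a \<in> S \<Longrightarrow> b \<in> S \<Longrightarrow> a + b \<in> S" and fin: "finite (UNIV - S)"
    and sym: "\<And>x. x \<notin> int ` S \<Longrightarrow> g - x \<in> int ` S"
    using assms by (auto simp: symmetric_numerical_semigroup_def numerical_semigroup_def g_def)
  obtain b where b: "\<And>n. n \<notin> S \<Longrightarrow> n \<le> b"
    using fin unfolding finite_nat_set_iff_bounded_le by auto
  then have "Suc b \<in> S" by force
  then have m: "m \<in> S" "0 < m"
    using LeastI[of "\<lambda>n. n \<in> S \<and> 0 < n" "Suc b"]
    by (auto simp: m_def multiplicity_of_semigroup_def)
  have below_m: "n \<notin> S" if "0 < n" "n < m" for n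
    using not_less_Least that unfolding m_def multiplicity_of_semigroup_def by blast

  let ?realizes = "\<lambda>d. 1 \<le> d \<and> (\<exists>A \<in> carrier_mat d d. S = exponent_semigroup A)"
  obtain A0 where "A0 \<in> carrier_mat (Suc b) (Suc b)" "S = exponent_semigroup A0"
    using cofinite_monoid_is_exponent_semigroup[OF S, of "Suc b"] b
    by (metis le_imp_less_Suc)
  then have "?realizes (Suc b)" by auto
  then have "?realizes (matricial_dimension S)"
    unfolding matricial_dimension_def by (rule LeastI)
  then obtain A where d: "1 \<le> matricial_dimension S"
    and A: "A \<in> carrier_mat (matricial_dimension S) (matricial_dimension S)"
    and SA: "S = exponent_semigroup A" by blast

  have "m \<le> matricial_dimension S"
  proof (rule ccontr)
    assume "\<not> m \<le> matricial_dimension S"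
    then have less: "matricial_dimension S < m" by simp
    with d have "1 \<notin> S" using below_m by simp
    then have "S \<noteq> UNIV" by blast
    then have g: "g = int (Max (UNIV - S))" and gap: "Max (UNIV - S) \<notin> S"
      using Max_in[of "UNIV - S"] fin by (auto simp: g_def frobenius_number_def)
    \<comment> \<open>The window of length \<open>matricial_dimension S\<close> below the largest gap then consists of
      reflections of the gaps below \<open>m\<close>, so it lies in \<open>S\<close>.\<close>
    have "Max (UNIV - S) \<in> S"
      unfolding SA
    proof (rule exponent_semigroup_window[OF A m(2) m(1)[unfolded SA]])
      fix k assume "0 < k" "k \<le> matricial_dimension S"
      with less have "k \<notin> S" using below_m by simp
      then have "g - int k \<in> int ` S" by (intro sym) auto
      then obtain s where "s \<in> S" "g - int k = int s" by blast
      moreover from this have "Max (UNIV - S) = s + k" unfolding g by linarith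
      ultimately show "k \<le> Max (UNIV - exponent_semigroup A)
          \<and> Max (UNIV - exponent_semigroup A) - k \<in> exponent_semigroup A"
        unfolding SA[symmetric] by simp
    qed
    with gap show False by blast
  qed
  then show ?thesis by (simp add: m_def)
qed

end
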